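(* For every integer $k\ge 1$ and every integer $n\ge 0$, $$B_3(3^k n+3^k-1)\equiv 0 \pmod{3^{2k}},$$ $$B_3(3^k n+2\cdot 3^{k-1}-1)\equiv 0 \pmod{3^{2k-1}}.$$
   Context: A partition is a 3-core if none of its hook numbers is a multiple of 3 (the empty partition is a 3-core). For an integer $n\ge 0$, $B_3(n)$ denotes the number of partition triples of $n$ with 3-cores, i.e. ordered triples $(\lambda_1,\lambda_2,\lambda_3)$ of (possibly empty) partitions, each a 3-core, such that the sum of all the parts of $\lambda_1,\lambda_2,\lambda_3$ equals $n$; in particular $B_3(0)=1$. Equivalently (a standard fact recalled in the paper), $\sum_{n\ge 0}B_3(n)q^n=\dfrac{f_3^9}{f_1^3}$, where $f_k=\prod_{m=1}^{\infty}(1-q^{km})$. *)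

theory Defs
  imports "HOL-Number_Theory.Cong"
begin

text \<open>A partition is the list of its parts, in weakly decreasing order; rows and columns of its
  Young diagram are numbered from 0.\<close>

definition is_partition :: "nat list \<Rightarrow> bool" where
  "is_partition xs \<longleftrightarrow> sorted_wrt (\<ge>) xs \<and> 0 \<notin> set xs"

definition young_diagram :: "nat list \<Rightarrow> (nat \<times> nat) set" where
  "young_diagram xs = {(i, j). i < length xs \<and> j < xs ! i}"

text \<open>The hook of a cell consists of the cell itself, the cells to its right in the same row and the
  cells below it in the same column.\<close>

definition hook_number :: "nat list \<Rightarrow> nat \<Rightarrow> nat \<Rightarrow> nat" where
  "hook_number xs i j =
     card {(i', j') \<in> young_diagram xs. (i' = i \<and> j' \<ge> j) \<or> (j' = j \<and> i' \<ge> i)}"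

definition is_core :: "nat \<Rightarrow> nat list \<Rightarrow> bool" where
  "is_core t xs \<longleftrightarrow> is_partition xs \<and> (\<forall>(i, j) \<in> young_diagram xs. \<not> t dvd hook_number xs i j)"

definition core_triples :: "nat \<Rightarrow> nat \<Rightarrow> (nat list \<times> nat list \<times> nat list) set" where
  "core_triples t n = {(xs, ys, zs). is_core t xs \<and> is_core t ys \<and> is_core t zs \<and>
     sum_list xs + sum_list ys + sum_list zs = n}"

definition B3 :: "nat \<Rightarrow> nat" where
  "B3 n = card (core_triples 3 n)"

text \<open>Finiteness makes the cardinality in the definition of \<^const>\<open>B3\<close> meaningful.\<close>

lemma length_le_sum_list_if_is_partition:
  assumes "is_partition xs"
  shows "length xs \<le> sum_list xs"
  using assms by (induction xs) (auto simp: is_partition_def)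

lemma finite_core_triples: "finite (core_triples t n)"
proof -
  let ?L = "{xs :: nat list. set xs \<subseteq> {..n} \<and> length xs \<le> n}"
  have L: "xs \<in> ?L" if "is_core t xs" "sum_list xs \<le> n" for xs
    using that length_le_sum_list_if_is_partition[of xs] member_le_sum_list[of _ xs]
    by (force simp: is_core_def)
  have "core_triples t n \<subseteq> ?L \<times> ?L \<times> ?L"
  proof
    fix p assume "p \<in> core_triples t n"
    then obtain xs ys zs where "p = (xs, ys, zs)" "is_core t xs" "is_core t ys" "is_core t zs"
      "sum_list xs + sum_list ys + sum_list zs = n"
      by (auto simp: core_triples_def)
    with L[of xs] L[of ys] L[of zs] show "p \<in> ?L \<times> ?L \<times> ?L" by simp
  qed
  moreover have "finite ?L" by (rule finite_lists_length_le) simp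
  ultimately show ?thesis by (meson finite_SigmaI finite_subset)
qed

lemma B3_0: "B3 0 = 1"
proof -
  have "core_triples 3 0 = {([], [], [])}"
  proof -
    have "is_core 3 xs \<and> sum_list xs = 0 \<longleftrightarrow> xs = []" for xs
      using length_le_sum_list_if_is_partition[of xs]
      by (cases xs) (auto simp: is_core_def young_diagram_def is_partition_def)
    then show ?thesis unfolding core_triples_def by auto
  qed
  then show ?thesis by (simp add: B3_def)
qed

end

theory Submission
  imports Defs
begin

text \<open>The divisibility by powers of 9 comes from the exact recurrence
  \<open>B3 (3 n + 2) = 9 B3 n\<close> (\<open>B3_rec\<close>). It iterates to \<open>B3 (3^k (m + 1) - 1) = 9^k B3 m\<close>: for
  \<open>m = n\<close> this is the first congruence. For \<open>m = 3 n + 1\<close>, with \<open>k - 1\<close> in place of \<open>k\<close>, it leaves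
  one more factor 3 to be found for the second congruence. That factor comes from cyclically shifting
  the three cores: a triple fixed by the shift has a total size divisible by 3
  (\<open>three_dvd_B3\<close>).

  The recurrence is proved by counting vectors over the Eisenstein integers. Write \<open>\<omega>\<close> for a primitive
  cube root of unity and \<open>\<theta> = 1 + 2 \<omega>\<close>, a square root of -3. On a beta set, being a 3-core means that
  the beads sit as low as possible on each of the three runners of an abacus. Runner 0 is
  empty because no part is 0, so a 3-core is given by the numbers \<open>p\<close> and \<open>q\<close> of beads on runners 1 and
  2, and its size is \<open>p\<^sup>2 - p q + q\<^sup>2 + q\<close>. If this size is \<open>m\<close>, then \<open>3 m + 1\<close> is the norm of
  \<open>1 - \<theta> (p + q \<omega>)\<close>. For arbitrary integers \<open>p\<close>, \<open>q\<close> these numbers form the whole class of 1 modulo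
  \<open>\<theta>\<close>, and multiplication by \<open>\<omega>\<close> permutes that class; the quadrant \<open>p, q \<ge> 0\<close> is a fundamental
  domain for it. Hence \<open>27 B3 n\<close> is the number of vectors of norm \<open>3 (n + 1)\<close> in \<open>\<int>[\<omega>]\<^sup>3\<close> whose
  entries are all 1 modulo \<open>\<theta>\<close> (\<open>card_lattice_triples\<close>).

  The linear map
  \<open>(u, v, w) \<mapsto> (- u + v + w, - u + \<omega>\<^sup>2 v + \<omega> w, - u + \<omega> v + \<omega>\<^sup>2 w)\<close>
  multiplies the norm by 3 and preserves the class of 1 modulo \<open>\<theta>\<close>. The entries of its values are
  congruent to one another modulo 3, and every vector of norm divisible by 9 with this
  property is a value. Finally, 1, \<open>\<omega>\<close> and \<open>\<omega>\<^sup>2\<close> represent the three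
  classes modulo 3 inside the class of 1 modulo \<open>\<theta>\<close>, so in an arbitrary vector the second and the third
  entry can be made congruent to the first by powers of \<open>\<omega>\<close> in exactly one way. These \<open>3 \<cdot> 3\<close>
  choices are the factor 9 (\<open>card_lattice_triples_rec\<close>).\<close>

section \<open>Cores and beta sets\<close>

text \<open>The beta set consists of the hook numbers of the cells in the first column.\<close>

fun beta_set :: "nat list \<Rightarrow> nat set" where
  "beta_set [] = {}"
| "beta_set (x # xs) = insert (x + length xs) (beta_set xs)"

lemma is_partition_Cons:
  "is_partition (x # xs) \<longleftrightarrow> x > 0 \<and> (\<forall>y\<in>set xs. y \<le> x) \<and> is_partition xs"
  by (auto simp: is_partition_def)

lemma hook_number_Cons_0:
  assumes "j < x"
  shows "hook_number (x # xs) 0 j = (x - j) + length (filter (\<lambda>y. j < y) xs)"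
proof -
  let ?arm = "{0::nat} \<times> {j..<x}"
  let ?leg = "(\<lambda>i. (Suc i, j)) ` {i. i < length xs \<and> j < xs ! i}"
  have hook: "{(i', j') \<in> young_diagram (x # xs). (i' = 0 \<and> j' \<ge> j) \<or> (j' = j \<and> i' \<ge> 0)}
      = ?arm \<union> ?leg" (is "?H = _")
  proof (rule set_eqI)
    fix c :: "nat \<times> nat"
    obtain i' j' where c: "c = (i', j')" by (cases c)
    show "c \<in> ?H \<longleftrightarrow> c \<in> ?arm \<union> ?leg"
      using assms unfolding c by (cases i') (auto simp: young_diagram_def)
  qed
  have "card (?arm \<union> ?leg) = card ?arm + card ?leg"
    by (rule card_Un_disjoint) auto
  also have "card ?leg = card {i. i < length xs \<and> j < xs ! i}"
    by (rule card_image) (auto simp: inj_on_def)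
  also have "card ?arm = x - j"
    by (simp add: card_cartesian_product)
  finally show ?thesis
    unfolding hook_number_def hook by (simp add: length_filter_conv_card)
qed

lemma hook_number_Cons_Suc: "hook_number (x # xs) (Suc i) j = hook_number xs i j"
proof -
  let ?hook = "\<lambda>xs i. {(i', j') \<in> young_diagram xs. (i' = i \<and> j' \<ge> j) \<or> (j' = j \<and> i' \<ge> i)}"
  have "?hook (x # xs) (Suc i) = (\<lambda>(i', j'). (Suc i', j')) ` ?hook xs i"
  proof (rule set_eqI)
    fix c :: "nat \<times> nat"
    obtain i' j' where c: "c = (i', j')" by (cases c)
    show "c \<in> ?hook (x # xs) (Suc i) \<longleftrightarrow> c \<in> (\<lambda>(i', j'). (Suc i', j')) ` ?hook xs i"
      unfolding c by (cases i') (auto simp: young_diagram_def image_iff)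
  qed
  moreover have "card ((\<lambda>(i', j'). (Suc i', j')) ` ?hook xs i) = card (?hook xs i)"
    by (rule card_image) (auto simp: inj_on_def)
  ultimately show ?thesis
    by (simp add: hook_number_def)
qed

text \<open>Follow the lower right boundary of the diagram from its bottom left corner, numbering the unit steps from
0. The beta set collects the numbers of the upward steps, and the step to the right below column \<open>j\<close> has
number \<open>j\<close> plus the number of rows of length at most \<open>j\<close>.\<close>

lemma notin_beta_set_iff:
  assumes "is_partition xs"
  shows "h \<notin> beta_set xs \<longleftrightarrow> (\<exists>j. h = j + length (filter (\<lambda>y. y \<le> j) xs))"
  using assms
proof (induction xs)
  case Nil
  then show ?case by simp
next
  case (Cons y ys)
  have y: "\<forall>z\<in>set ys. z \<le> y" and ys: "is_partition ys"
    using Cons.prems by (auto simp: is_partition_Cons)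
  have all: "length (filter (\<lambda>z. z \<le> j) ys) = length ys" if "y \<le> j" for j
    using y that by (subst filter_True) auto
  have le: "length (filter (\<lambda>z. z \<le> j) ys) \<le> length ys" for j
    by simp
  show ?case
  proof
    assume "h \<notin> beta_set (y # ys)"
    then have h: "h \<noteq> y + length ys" "h \<notin> beta_set ys" by auto
    then obtain j where j: "h = j + length (filter (\<lambda>z. z \<le> j) ys)"
      using Cons.IH ys by blast
    show "\<exists>j. h = j + length (filter (\<lambda>z. z \<le> j) (y # ys))"
    proof (cases "j < y")
      case True
      then have "h = j + length (filter (\<lambda>z. z \<le> j) (y # ys))" using j by simp
      then show ?thesis by blast
    next
      case False
      then have "h = (j - 1) + length (filter (\<lambda>z. z \<le> j - 1) (y # ys))"
        using j h all[of j] all[of "j - 1"] by (cases "j = y") auto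
      then show ?thesis by blast
    qed
  next
    assume "\<exists>j. h = j + length (filter (\<lambda>z. z \<le> j) (y # ys))"
    then obtain j where j: "h = j + length (filter (\<lambda>z. z \<le> j) (y # ys))" by blast
    show "h \<notin> beta_set (y # ys)"
    proof (cases "j < y")
      case True
      then have h: "h = j + length (filter (\<lambda>z. z \<le> j) ys)" using j by simp
      then have "h \<notin> beta_set ys" using Cons.IH ys by blast
      moreover have "h < y + length ys" using h True le[of j] by linarith
      ultimately show ?thesis by simp
    next
      case False
      then have h: "h = Suc j + length (filter (\<lambda>z. z \<le> Suc j) ys)"
        using j all[of j] all[of "Suc j"] by simp
      then have "h \<notin> beta_set ys" using Cons.IH ys by blast
      then show ?thesis using h False all[of "Suc j"] by simp
    qed
  qed
qed

text \<open>In the numbering of boundary steps, the hook number of a cell is the difference between the upward step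
of its row and the step to the right of its column. So the hook numbers of the first row
are the differences between its own element of the beta set and the gaps below that element.\<close>

lemma is_core_Cons:
  "is_core t (x # xs) \<longleftrightarrow> is_partition (x # xs) \<and> is_core t xs \<and>
     (\<forall>h < x + length xs. t dvd x + length xs - h \<longrightarrow> h \<in> beta_set xs)"
proof (cases "is_partition (x # xs)")
  case False
  then show ?thesis by (simp add: is_core_def)
next
  case True
  then have xs: "is_partition xs" and x: "\<forall>y\<in>set xs. y \<le> x"
    by (auto simp: is_partition_Cons)
  \<comment> \<open>the number of the boundary step below column \<open>j\<close>\<close>
  define gap where "gap j = j + length (filter (\<lambda>y. y \<le> j) xs)" for j
  have hook: "hook_number (x # xs) 0 j = x + length xs - gap j" if "j < x" for j
  proof -
    have "length (filter (\<lambda>y. j < y) xs) + length (filter (\<lambda>y. y \<le> j) xs) = length xs"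
      using sum_length_filter_compl[of "\<lambda>y. j < y" xs] by (simp add: not_less)
    then show ?thesis
      using that by (simp add: hook_number_Cons_0 gap_def)
  qed
  have gap_less: "gap j < x + length xs \<longleftrightarrow> j < x" for j
  proof (cases "j < x")
    case True
    then show ?thesis
      using length_filter_le[of "\<lambda>y. y \<le> j" xs] by (simp add: gap_def add_less_le_mono)
  next
    case False
    then have "filter (\<lambda>y. y \<le> j) xs = xs" using x by (intro filter_True) auto
    then show ?thesis using False by (simp add: gap_def)
  qed
  have cells: "(\<forall>(i, j) \<in> young_diagram (x # xs). P i j) \<longleftrightarrow>
      (\<forall>j<x. P 0 j) \<and> (\<forall>(i, j) \<in> young_diagram xs. P (Suc i) j)" for P
    unfolding young_diagram_def by (auto simp: less_Suc_eq_0_disj nth_Cons')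
  have "(\<forall>j<x. \<not> t dvd hook_number (x # xs) 0 j) \<longleftrightarrow>
        (\<forall>h < x + length xs. t dvd x + length xs - h \<longrightarrow> h \<in> beta_set xs)"
    using notin_beta_set_iff[OF xs] gap_less hook by (metis gap_def)
  then show ?thesis
    using True xs by (auto simp: is_core_def cells hook_number_Cons_Suc)
qed

section \<open>Parametrisation of the 3-cores\<close>

text \<open>The 3-core whose beta set is \<open>{1, 4, \<dots>, 3 p - 2} \<union> {2, 5, \<dots>, 3 q - 1}\<close>. The recursion takes off the
first row, that is, the largest element of the beta set: it is \<open>3 p - 2\<close> if \<open>q < p\<close>, and \<open>3 q - 1\<close>
otherwise. The part itself is this element minus the number \<open>p + q - 1\<close> of remaining rows.\<close>

fun three_core :: "nat \<times> nat \<Rightarrow> nat list" where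
  "three_core (p, q) =
     (if q < p then (2 * p - q - 1) # three_core (p - 1, q)
      else if 0 < q then (2 * q - p) # three_core (p, q - 1)
      else [])"

declare three_core.simps [simp del]

lemma three_core_simps:
  "three_core (0, 0) = []"
  "q \<le> p \<Longrightarrow> three_core (Suc p, q) = (2 * p - q + 1) # three_core (p, q)"
  "p \<le> Suc q \<Longrightarrow> three_core (p, Suc q) = (2 * q + 2 - p) # three_core (p, q)"
  by (subst three_core.simps; simp)+

text \<open>Every pair is reached from \<open>(0, 0)\<close> by adding the beads in increasing order of their positions.\<close>

lemma three_core_induct [case_names zero left right]:
  assumes "P 0 0"
    and "\<And>p q. q \<le> p \<Longrightarrow> P p q \<Longrightarrow> P (Suc p) q"
    and "\<And>p q. p \<le> Suc q \<Longrightarrow> P p q \<Longrightarrow> P p (Suc q)"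
  shows "P p q"
proof (induction "p + q" arbitrary: p q)
  case 0
  then show ?case using assms(1) by simp
next
  case (Suc m)
  show ?case
  proof (cases "q < p")
    case True
    then obtain p' where "p = Suc p'" by (cases p) auto
    then show ?thesis using True Suc assms(2)[of q p'] by simp
  next
    case False
    then obtain q' where "q = Suc q'" using Suc.hyps(2) by (cases q) auto
    then show ?thesis using False Suc assms(3)[of p q'] by simp
  qed
qed

lemma length_three_core: "length (three_core (p, q)) = p + q"
  by (induction p q rule: three_core_induct) (auto simp: three_core_simps)

lemma beta_set_three_core:
  "beta_set (three_core (p, q)) = (\<lambda>i. 3 * i + 1) ` {..<p} \<union> (\<lambda>i. 3 * i + 2) ` {..<q}"
proof (induction p q rule: three_core_induct)
  case zero
  then show ?case by (simp add: three_core_simps)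
next
  case (left p q)
  then have "2 * p - q + 1 + (p + q) = 3 * p + 1" by simp
  with left show ?case by (simp add: three_core_simps length_three_core lessThan_Suc)
next
  case (right p q)
  then have "2 * q + 2 - p + (p + q) = 3 * q + 2" by simp
  with right show ?case by (simp add: three_core_simps length_three_core lessThan_Suc)
qed

text \<open>The largest part belongs to the largest bead. This bound is what makes the list of parts decreasing when
the next bead is added.\<close>

lemma three_core_parts_le:
  "x \<in> set (three_core (p, q)) \<Longrightarrow> x + p + q \<le> max (3 * p - 2) (3 * q - 1) + 1"
proof (induction p q rule: three_core_induct)
  case zero
  then show ?case by (simp add: three_core_simps)
next
  case (left p q)
  then show ?case by (auto simp: three_core_simps max_def split: if_splits)
next
  case (right p q)
  then show ?case by (auto simp: three_core_simps max_def split: if_splits)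
qed

lemma is_core_three_core: "is_core 3 (three_core (p, q))"
proof (induction p q rule: three_core_induct)
  case zero
  then show ?case
    by (simp add: three_core_simps is_core_def is_partition_def young_diagram_def)
next
  case (left p q)
  have len: "2 * p - q + 1 + (p + q) = 3 * p + 1" using left by simp
  have part: "is_partition ((2 * p - q + 1) # three_core (p, q))"
    using left three_core_parts_le[of _ p q]
    by (fastforce simp: is_partition_Cons is_core_def max_def split: if_splits)
  have "h \<in> beta_set (three_core (p, q))" if less: "h < 3 * p + 1" and dvd: "3 dvd 3 * p + 1 - h" for h
  proof -
    obtain k where k: "3 * p + 1 - h = 3 * k" using dvd by (auto elim: dvdE)
    then have "h = 3 * (p - k) + 1" "p - k < p" using less k by auto
    then show ?thesis by (auto simp: beta_set_three_core)
  qed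
  then show ?case
    using left part len by (simp add: three_core_simps is_core_Cons length_three_core)
next
  case (right p q)
  have len: "2 * q + 2 - p + (p + q) = 3 * q + 2" using right by simp
  have part: "is_partition ((2 * q + 2 - p) # three_core (p, q))"
    using right three_core_parts_le[of _ p q]
    by (fastforce simp: is_partition_Cons is_core_def max_def split: if_splits)
  have "h \<in> beta_set (three_core (p, q))" if less: "h < 3 * q + 2" and dvd: "3 dvd 3 * q + 2 - h" for h
  proof -
    obtain k where k: "3 * q + 2 - h = 3 * k" using dvd by (auto elim: dvdE)
    then have "h = 3 * (q - k) + 2" "q - k < q" using less k by auto
    then show ?thesis by (auto simp: beta_set_three_core)
  qed
  then show ?case
    using right part len by (simp add: three_core_simps is_core_Cons length_three_core)
qed

lemma beta_set_less:
  assumes "is_partition xs" "\<forall>y\<in>set xs. y \<le> x" "h \<in> beta_set xs"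
  shows "h < x + length xs"
  using assms by (induction xs arbitrary: x) (fastforce simp: is_partition_Cons)+

text \<open>By \<open>is_core_Cons\<close>, below the bead of the first row every position in the same residue class is
occupied. Since 0 is not occupied, the new bead is on runner 1 or 2. There it has to be the next free
position: all lower ones are occupied, and it exceeds every bead that is already present.\<close>

lemma ex_three_core:
  assumes "is_core 3 xs"
  shows "\<exists>p q. xs = three_core (p, q)"
  using assms
proof (induction xs)
  case Nil
  then show ?case using three_core_simps(1) by metis
next
  case (Cons x xs)
  then have part: "is_partition (x # xs)" and core: "is_core 3 xs"
    and closed: "\<And>h. h < x + length xs \<Longrightarrow> 3 dvd x + length xs - h \<Longrightarrow> h \<in> beta_set xs"
    by (auto simp: is_core_Cons)
  obtain p q where xs: "xs = three_core (p, q)" using Cons.IH core by blast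
  define m where "m = x + length xs"
  have m: "m = x + p + q" by (simp add: m_def xs length_three_core)
  have beta: "h \<in> beta_set xs \<longleftrightarrow> (\<exists>i<p. h = 3 * i + 1) \<or> (\<exists>i<q. h = 3 * i + 2)" for h
    unfolding xs beta_set_three_core by auto
  have less: "h < m" if "h \<in> beta_set xs" for h
    using beta_set_less[of xs x h] part that by (auto simp: is_partition_Cons m_def)
  have less1: "3 * i + 1 < m" if "i < p" for i
    using less that by (simp add: beta)
  have less2: "3 * i + 2 < m" if "i < q" for i
    using less that by (simp add: beta)
  have "m > 0" using part by (simp add: m_def is_partition_Cons)
  have "m = 3 * (m div 3) \<or> m = 3 * (m div 3) + 1 \<or> m = 3 * (m div 3) + 2" by presburger
  then consider a where "m = 3 * a" | a where "m = 3 * a + 1" | a where "m = 3 * a + 2"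
    by blast
  then show ?case
  proof cases
    case 1
    then have "0 \<in> beta_set xs" using closed[of 0] \<open>m > 0\<close> by (simp add: m_def[symmetric])
    then show ?thesis by (simp add: beta)
  next
    case (2 a)
    have "a \<le> p"
    proof (cases a)
      case (Suc b)
      then have "3 * b + 1 \<in> beta_set xs"
        using closed[of "3 * b + 1"] 2 by (simp add: m_def[symmetric])
      then show ?thesis using Suc unfolding beta by presburger
    qed simp
    moreover have "p \<le> a" using less1[of a] 2 by (cases "a < p") auto
    moreover have "q \<le> a" using less2[of a] 2 by (cases "a < q") auto
    ultimately have "q \<le> p" "x = 2 * p - q + 1" using m 2 by auto
    then have "x # xs = three_core (Suc p, q)" by (simp add: xs three_core_simps)
    then show ?thesis by blast
  next
    case (3 a)
    have "a \<le> q"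
    proof (cases a)
      case (Suc b)
      then have "3 * b + 2 \<in> beta_set xs"
        using closed[of "3 * b + 2"] 3 by (simp add: m_def[symmetric])
      then show ?thesis using Suc unfolding beta by presburger
    qed simp
    moreover have "q \<le> a" using less2[of a] 3 by (cases "a < q") auto
    moreover have "p \<le> Suc a" using less1[of "Suc a"] 3 by (cases "Suc a < p") auto
    ultimately have "p \<le> Suc q" "x = 2 * q + 2 - p" using m 3 by auto
    then have "x # xs = three_core (p, Suc q)" by (simp add: xs three_core_simps)
    then show ?thesis by blast
  qed
qed

lemma inj_three_core: "inj three_core"
proof (rule injI)
  fix a b :: "nat \<times> nat"
  obtain p q p' q' where ab: "a = (p, q)" "b = (p', q')" by (cases a, cases b)
  assume "three_core a = three_core b"
  then have eq: "beta_set (three_core (p, q)) = beta_set (three_core (p', q'))"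
    by (simp add: ab)
  have "3 * i + 1 \<in> beta_set (three_core (r, s)) \<longleftrightarrow> i < r"
    and "3 * i + 2 \<in> beta_set (three_core (r, s)) \<longleftrightarrow> i < s" for i r s
    unfolding beta_set_three_core by (auto, presburger+)
  then have "i < p \<longleftrightarrow> i < p'" "i < q \<longleftrightarrow> i < q'" for i
    using eq by metis+
  then show "a = b"
    by (metis ab nat_neq_iff)
qed

lemma bij_betw_three_core: "bij_betw three_core UNIV {xs. is_core 3 xs}"
  using inj_three_core is_core_three_core ex_three_core by (fastforce simp: bij_betw_def)

section \<open>The hexagonal lattice\<close>

text \<open>With \<open>\<omega>\<close> and \<open>\<theta>\<close> as above, the pair \<open>(p, q)\<close> stands for the Eisenstein integer
\<open>1 - \<theta> (p + q \<omega>)\<close>, whose norm is \<open>3 core_form (p, q) + 1\<close>.\<close>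

definition core_form :: "int \<times> int \<Rightarrow> int" where
  "core_form = (\<lambda>(p, q). p\<^sup>2 - p * q + q\<^sup>2 + q)"

lemma sum_list_three_core: "int (sum_list (three_core (p, q))) = core_form (int p, int q)"
proof (induction p q rule: three_core_induct)
  case zero
  then show ?case by (simp add: three_core_simps core_form_def)
next
  case (left p q)
  then show ?case
    by (simp add: three_core_simps core_form_def of_nat_diff power2_eq_square algebra_simps)
next
  case (right p q)
  then show ?case
    by (simp add: three_core_simps core_form_def of_nat_diff power2_eq_square algebra_simps)
qed

text \<open>Multiplication of \<open>1 - \<theta> (p + q \<omega>)\<close> by \<open>\<omega>\<close>.\<close>

definition rot :: "int \<times> int \<Rightarrow> int \<times> int" where
  "rot = (\<lambda>(p, q). (- q - 1, p - q - 1))"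

lemma rot_Pair: "rot (p, q) = (- q - 1, p - q - 1)"
  by (simp add: rot_def)

lemma core_form_rot: "core_form (rot a) = core_form a"
  by (cases a) (simp add: core_form_def rot_def power2_eq_square algebra_simps)

lemma core_form_rot_funpow: "core_form ((rot ^^ i) a) = core_form a"
  by (induction i) (simp_all add: core_form_rot)

lemma rot_rot_rot: "rot (rot (rot a)) = a"
  by (cases a) (simp add: rot_def)

text \<open>The class of \<open>1 - \<theta> (p + q \<omega>)\<close> modulo 3: as \<open>\<theta>\<^sup>2 = - 3\<close>, it depends on \<open>p + q \<omega>\<close> modulo \<open>\<theta>\<close> only, and
\<open>\<omega>\<close> is 1 modulo \<open>\<theta>\<close>.\<close>

definition residue :: "int \<times> int \<Rightarrow> int" where
  "residue = (\<lambda>(p, q). (p + q) mod 3)"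

lemma residue_rot_funpow: "residue ((rot ^^ i) a) = (residue a + int i) mod 3"
proof (induction i)
  case 0
  then show ?case by (simp add: residue_def split: prod.splits)
next
  case (Suc i)
  obtain p q where pq: "(rot ^^ i) a = (p, q)" by fastforce
  have "residue (rot (p, q)) = (residue (p, q) + 1) mod 3"
    unfolding residue_def rot_def prod.case by presburger
  then show ?case
    using Suc unfolding pq by (simp add: pq mod_simps add_ac)
qed

lemma inj_rot_funpow: "inj (rot ^^ i)"
  by (intro inj_fn inj_on_inverseI[where g = "\<lambda>a. rot (rot a)"]) (simp add: rot_rot_rot)

text \<open>A rotation adds 1 to the residue, so a suitable one attains any given residue.\<close>

lemma ex_rot_residue:
  obtains i b' where "i < 3" "b = (rot ^^ i) b'" "residue b' = residue a"
proof -
  define i where "i = nat ((residue b - residue a) mod 3)"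
  have i: "i < 3" by (simp add: i_def nat_less_iff)
  have "(rot ^^ i) ((rot ^^ (3 - i)) b) = (rot ^^ (i + (3 - i))) b"
    by (simp only: funpow_add o_apply)
  also have "i + (3 - i) = Suc (Suc (Suc 0))" using i by simp
  finally have "b = (rot ^^ i) ((rot ^^ (3 - i)) b)" by (simp add: rot_rot_rot)
  moreover have "residue ((rot ^^ (3 - i)) b) = residue a"
  proof -
    have "residue a mod 3 = residue a" by (simp add: residue_def split: prod.splits)
    moreover have "(x + (3 - (x - y) mod 3)) mod 3 = y mod 3" for x y :: int by presburger
    then have "(residue b + int (3 - i)) mod 3 = residue a mod 3"
      using i by (simp add: of_nat_diff i_def)
    ultimately show ?thesis by (simp add: residue_rot_funpow)
  qed
  ultimately show ?thesis using that i by blast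
qed

text \<open>The quadrant \<open>p, q \<ge> 0\<close> is a sector of angle 120 degrees in the hexagonal lattice, and its three images
under the rotation tile the lattice. The centre of the rotation is not a lattice point, and the
boundary rays of one image lie beside those of the next instead of on them.\<close>

lemma bij_betw_rot_sector:
  "bij_betw (\<lambda>(i, p, q). (rot ^^ i) (int p, int q)) ({..<3} \<times> UNIV) UNIV"
proof -
  have rot2: "(rot ^^ 2) (p, q) = (q - p, - p - 1)" for p q
    by (simp add: numeral_2_eq_2 rot_Pair)
  have three: "{..<3::nat} = {0, 1, 2}" by auto
  show ?thesis
    unfolding bij_betw_def
  proof
    show "inj_on (\<lambda>(i, p, q). (rot ^^ i) (int p, int q)) ({..<3} \<times> UNIV)"
      unfolding three by (rule inj_onI) (auto simp: rot2 rot_Pair)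
    have "a \<in> (\<lambda>(i, p, q). (rot ^^ i) (int p, int q)) ` ({..<3} \<times> UNIV)" for a
    proof -
      obtain x y where a: "a = (x, y)" by (cases a)
      \<comment> \<open>the three images of the quadrant, in this order\<close>
      consider "0 \<le> x" "0 \<le> y" | "x < 0" "x \<le> y" | "y < 0" "y < x" by linarith
      then show ?thesis
      proof cases
        case 1
        then show ?thesis
          by (intro image_eqI[where x = "(0, nat x, nat y)"]) (simp_all add: a rot2 rot_Pair)
      next
        case 2
        then show ?thesis
          by (intro image_eqI[where x = "(1, nat (y - x), nat (- x - 1))"]) (simp_all add: a rot2 rot_Pair)
      next
        case 3
        then show ?thesis
          by (intro image_eqI[where x = "(2, nat (- y - 1), nat (x - y - 1))"]) (simp_all add: a rot2 rot_Pair)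
      qed
    qed
    then show "(\<lambda>(i, p, q). (rot ^^ i) (int p, int q)) ` ({..<3} \<times> UNIV) = UNIV" by blast
  qed
qed

section \<open>Triples of lattice points\<close>

definition triples :: "'a set \<Rightarrow> ('a \<Rightarrow> int) \<Rightarrow> int \<Rightarrow> ('a \<times> 'a \<times> 'a) set" where
  "triples A w n = {(a, b, c). a \<in> A \<and> b \<in> A \<and> c \<in> A \<and> w a + w b + w c = n}"

lemma card_triples_bij:
  assumes f: "bij_betw f A B" and w: "\<And>a. a \<in> A \<Longrightarrow> w' (f a) = w a"
  shows "card (triples A w n) = card (triples B w' n)"
proof -
  have inj: "inj_on f A" and B: "B = f ` A" using f by (auto simp: bij_betw_def)
  let ?f = "map_prod f (map_prod f f)"
  have "inj_on ?f (A \<times> A \<times> A)"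
    using inj by (intro map_prod_inj_on)
  moreover have "triples A w n \<subseteq> A \<times> A \<times> A"
    by (auto simp: triples_def)
  ultimately have "inj_on ?f (triples A w n)"
    by (rule inj_on_subset)
  moreover have "?f ` triples A w n = triples B w' n"
  proof (intro equalityI subsetI)
    fix v assume "v \<in> ?f ` triples A w n"
    then show "v \<in> triples B w' n" by (auto simp: triples_def B w)
  next
    fix v assume "v \<in> triples B w' n"
    then obtain a b c where v: "v = ?f (a, b, c)" and "a \<in> A" "b \<in> A" "c \<in> A"
      "w' (f a) + w' (f b) + w' (f c) = n"
      unfolding triples_def B by auto
    then have "(a, b, c) \<in> triples A w n" by (simp add: triples_def w)
    then show "v \<in> ?f ` triples A w n" unfolding v by (rule imageI)
  qed
  ultimately have "bij_betw ?f (triples A w n) (triples B w' n)"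
    by (simp add: bij_betw_def)
  then show ?thesis by (rule bij_betw_same_card)
qed

lemma card_triples_prod:
  "card (triples (I \<times> A) (\<lambda>(i, a). w a) n) = card I ^ 3 * card (triples A w n)"
proof -
  have "bij_betw (\<lambda>((i, j, k), (a, b, c)). ((i, a), (j, b), (k, c)))
      ((I \<times> I \<times> I) \<times> triples A w n) (triples (I \<times> A) (\<lambda>(i, a). w a) n)"
    by (rule bij_betw_byWitness[where f' = "\<lambda>((i, a), (j, b), (k, c)). ((i, j, k), (a, b, c))"])
       (auto simp: triples_def)
  then have "card (triples (I \<times> A) (\<lambda>(i, a). w a) n) = card ((I \<times> I \<times> I) \<times> triples A w n)"
    by (simp add: bij_betw_same_card)
  then show ?thesis by (simp add: card_cartesian_product power3_eq_cube)
qed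

lemma B3_eq_card_triples: "B3 n = card (triples {xs. is_core 3 xs} (\<lambda>xs. int (sum_list xs)) (int n))"
  unfolding B3_def core_triples_def triples_def
  by (rule arg_cong[where f = card]) (auto simp flip: of_nat_add)

text \<open>Every lattice point is a power of the rotation applied to the point of a unique 3-core, with the same
value of the form. A triple thus carries three independent choices out of 3, which gives the factor 27.\<close>

lemma card_lattice_triples: "card (triples UNIV core_form (int n)) = 27 * B3 n"
proof -
  have "B3 n = card (triples UNIV (\<lambda>(p, q). core_form (int p, int q)) (int n))"
    unfolding B3_eq_card_triples
    by (rule card_triples_bij[OF bij_betw_three_core, symmetric])
       (auto simp: sum_list_three_core)
  moreover have "card (triples ({..<3::nat} \<times> UNIV) (\<lambda>(i, a). (\<lambda>(p, q). core_form (int p, int q)) a) (int n))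
      = card (triples UNIV core_form (int n))"
    by (rule card_triples_bij[OF bij_betw_rot_sector]) (auto simp: core_form_rot_funpow)
  ultimately show ?thesis
    unfolding card_triples_prod by simp
qed

section \<open>The recurrence\<close>

type_synonym lattice_triple = "(int \<times> int) \<times> (int \<times> int) \<times> (int \<times> int)"

text \<open>In terms of the numbers \<open>u\<close>, \<open>v\<close>, \<open>w\<close> that the three points stand for, this is the map
\<open>(u, v, w) \<mapsto> (- u + v + w, - u + \<omega>\<^sup>2 v + \<omega> w, - u + \<omega> v + \<omega>\<^sup>2 w)\<close>, up to the sign of \<open>u\<close> the discrete
Fourier transform of order 3. The sign is needed for the values to be 1 modulo \<open>\<theta>\<close> again.\<close>

definition dft :: "lattice_triple \<Rightarrow> lattice_triple" where
  "dft = (\<lambda>((p1, q1), (p2, q2), (p3, q3)).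
     ((- p1 + p2 + p3, - q1 + q2 + q3),
      (- 1 - p1 + q2 - p2 - q3, - 2 - q1 - p2 + p3 - q3),
      (- 1 - p1 - q2 + q3 - p3, - 2 - q1 + p2 - q2 - p3)))"

lemma inj_dft: "inj dft"
  by (rule injI) (auto simp: dft_def split: prod.splits)

text \<open>The matrix of the transform is \<open>\<theta>\<close> times a unitary matrix, so it multiplies the norm by 3. The
norm of a triple is 3 times its total form plus 3.\<close>

lemma core_form_dft:
  assumes "dft (a, b, c) = (a', b', c')"
  shows "core_form a' + core_form b' + core_form c'
    = 3 * (core_form a + core_form b + core_form c) + 2"
  using assms
  by (cases a; cases b; cases c)
     (auto simp: dft_def core_form_def power2_eq_square algebra_simps)

lemma residue_dft:
  assumes "dft (a, b, c) = (a', b', c')"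
  shows "residue b' = residue a'" "residue c' = residue a'"
proof -
  obtain p1 q1 p2 q2 p3 q3 where abc: "a = (p1, q1)" "b = (p2, q2)" "c = (p3, q3)"
    by (cases a, cases b, cases c)
  have "fst b' + snd b' = (fst a' + snd a') + 3 * (- 1 - p2 - q3)"
    and "fst c' + snd c' = (fst a' + snd a') + 3 * (- 1 - q2 - p3)"
    using assms by (auto simp: abc dft_def)
  then show "residue b' = residue a'" "residue c' = residue a'"
    by (simp_all only: residue_def case_prod_beta mod_mult_self2)
qed

text \<open>The inverse transform divides by 3. When the three residues agree, the numerators are congruent modulo 3 to a
constant plus or minus the sum of the second coordinates, and the condition on the form says
that this sum is 2 modulo 3, which is exactly what divisibility by 3 requires.\<close>

lemma ex_dft:
  assumes res: "residue b = residue a" "residue c = residue a"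
    and form: "(core_form a + core_form b + core_form c) mod 3 = 2"
  shows "(a, b, c) \<in> range dft"
proof -
  obtain p1 q1 p2 q2 p3 q3 where abc: "a = (p1, q1)" "b = (p2, q2)" "c = (p3, q3)"
    by (cases a, cases b, cases c)
  define r where "r = p1 + q1"
  have "3 dvd (p2 + q2) - r" "3 dvd (p3 + q3) - r"
    using res by (simp_all add: abc residue_def r_def mod_eq_dvd_iff)
  then obtain s t where "p2 + q2 - r = 3 * s" "p3 + q3 - r = 3 * t"
    by (auto elim!: dvdE)
  then have s: "p2 = r - q2 + 3 * s" and t: "p3 = r - q3 + 3 * t"
    by simp_all
  have "core_form a + core_form b + core_form c = q1 + q2 + q3 +
      3 * (r\<^sup>2 - p1 * q1 - p2 * q2 - p3 * q3 + 2 * r * s + 3 * s\<^sup>2 + 2 * r * t + 3 * t\<^sup>2)"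
    unfolding abc core_form_def s t by (simp add: r_def power2_eq_square algebra_simps)
  then have "(q1 + q2 + q3) mod 3 = 2"
    using form by (simp only: mod_mult_self2)
  moreover define u where "u = (q1 + q2 + q3) div 3"
  ultimately have u: "q1 = 2 - q2 - q3 + 3 * u"
    using mult_div_mod_eq[of 3 "q1 + q2 + q3"] by linarith
  have p1: "p1 = r - q1" by (simp add: r_def)
  \<comment> \<open>the inverse transform, with the division by 3 carried out in terms of \<open>s\<close>, \<open>t\<close> and \<open>u\<close>\<close>
  have "(a, b, c) = dft
    ((- r - s - t + u, - u - 2), (- 1 - u + q3 - t, u - q2 + s - t), (- 1 - u + q2 - s, u - q3 + t - s))"
    by (simp add: abc dft_def p1 s t u)
  then show ?thesis by blast
qed

text \<open>A triple counted on the left is turned into a value of the transform by rotating its second and third point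
until their residues agree with that of the first. Both rotations are determined by the triple, since the
points of a transformed triple have equal residues and a rotation shifts the residue.\<close>

lemma card_lattice_triples_rec:
  "card (triples UNIV core_form (3 * n + 2)) = 9 * card (triples UNIV core_form n)"
proof -
  define F where "F = (\<lambda>((i, j), v). case dft v of (a, b, c) \<Rightarrow> (a, (rot ^^ i) b, (rot ^^ j) c))"
  let ?D = "({..<3::nat} \<times> {..<3::nat}) \<times> triples UNIV core_form n"
  have F: "F ((i, j), v) = (a, (rot ^^ i) b, (rot ^^ j) c)" if "dft v = (a, b, c)" for i j v a b c
    using that by (simp add: F_def)
  have cancel: "k = l" if "(x + int k) mod 3 = (x + int l) mod 3" "k < 3" "l < 3" for x k l
  proof -
    have "[x + int k = x + int l] (mod int 3)" using that(1) by (simp add: cong_def)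
    then have "[k = l] (mod 3)" by (simp only: cong_add_lcancel cong_int_iff)
    then show ?thesis using that by (intro cong_less_modulus_unique_nat)
  qed
  have "inj_on F ?D"
  proof (rule inj_onI)
    fix d d' assume D: "d \<in> ?D" "d' \<in> ?D" and eq: "F d = F d'"
    obtain i j v i' j' v' where d: "d = ((i, j), v)" "d' = ((i', j'), v')"
      by (cases d, cases d') auto
    obtain a b c a' b' c' where v: "dft v = (a, b, c)" "dft v' = (a', b', c')"
      by (cases "dft v", cases "dft v'")
    have lt: "i < 3" "j < 3" "i' < 3" "j' < 3" using D by (auto simp: d)
    have ab: "a = a'" "(rot ^^ i) b = (rot ^^ i') b'" "(rot ^^ j) c = (rot ^^ j') c'"
      using eq by (simp_all add: d F[OF v(1)] F[OF v(2)])
    have res: "residue b = residue a" "residue b' = residue a"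
      "residue c = residue a" "residue c' = residue a"
      using residue_dft[of "fst v" "fst (snd v)" "snd (snd v)"]
        residue_dft[of "fst v'" "fst (snd v')" "snd (snd v')"] v ab(1) by auto
    have "(residue a + int i) mod 3 = (residue a + int i') mod 3"
      using arg_cong[OF ab(2), of residue] by (simp add: residue_rot_funpow res)
    then have i: "i = i'" using cancel lt by blast
    have "(residue a + int j) mod 3 = (residue a + int j') mod 3"
      using arg_cong[OF ab(3), of residue] by (simp add: residue_rot_funpow res)
    then have j: "j = j'" using cancel lt by blast
    have "b = b'" "c = c'" using ab inj_rot_funpow by (auto simp: i j dest: injD)
    then have "dft v = dft v'" using v ab by simp
    then show "d = d'" using inj_dft by (simp add: d i j inj_eq)
  qed
  moreover have "F ` ?D = triples UNIV core_form (3 * n + 2)"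
  proof (intro equalityI subsetI)
    fix w assume "w \<in> F ` ?D"
    then obtain i j x y z where w: "w = F ((i, j), (x, y, z))"
      and xyz: "core_form x + core_form y + core_form z = n"
      by (auto simp: triples_def)
    obtain a b c where v: "dft (x, y, z) = (a, b, c)" by (cases "dft (x, y, z)")
    show "w \<in> triples UNIV core_form (3 * n + 2)"
      using core_form_dft[OF v] xyz
      by (simp add: w F[OF v] triples_def core_form_rot_funpow)
  next
    fix w assume "w \<in> triples UNIV core_form (3 * n + 2)"
    then obtain a b c where w: "w = (a, b, c)"
      and form: "core_form a + core_form b + core_form c = 3 * n + 2"
      by (auto simp: triples_def)
    obtain i b' where b: "i < 3" "b = (rot ^^ i) b'" "residue b' = residue a"
      using ex_rot_residue by metis
    obtain j c' where c: "j < 3" "c = (rot ^^ j) c'" "residue c' = residue a"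
      using ex_rot_residue by metis
    have form': "core_form a + core_form b' + core_form c' = 3 * n + 2"
      using form by (simp add: b c core_form_rot_funpow)
    then have "(core_form a + core_form b' + core_form c') mod 3 = 2" by presburger
    then obtain x y z where xyz: "dft (x, y, z) = (a, b', c')"
      using ex_dft[OF b(3) c(3)] by (metis imageE prod_cases3)
    have "core_form x + core_form y + core_form z = n"
      using core_form_dft[OF xyz] form' by simp
    then have "((i, j), (x, y, z)) \<in> ?D" using b c by (simp add: triples_def)
    moreover have "w = F ((i, j), (x, y, z))" by (simp add: F[OF xyz] w b c)
    ultimately show "w \<in> F ` ?D" by blast
  qed
  ultimately have "bij_betw F ?D (triples UNIV core_form (3 * n + 2))"
    by (simp add: bij_betw_def)
  then have "card (triples UNIV core_form (3 * n + 2))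
      = card (({..<3::nat} \<times> {..<3::nat}) \<times> triples UNIV core_form n)"
    by (simp add: bij_betw_same_card)
  then show ?thesis by (simp add: card_cartesian_product)
qed

lemma B3_rec: "B3 (3 * n + 2) = 9 * B3 n"
proof -
  have "27 * B3 (3 * n + 2) = card (triples UNIV core_form (3 * int n + 2))"
    using card_lattice_triples[of "3 * n + 2"] by (simp add: add.commute)
  then show ?thesis
    using card_lattice_triples_rec[of "int n"] card_lattice_triples[of n] by linarith
qed

lemma B3_iterate: "B3 (3 ^ k * (m + 1) - 1) = 9 ^ k * B3 m"
proof (induction k)
  case 0
  then show ?case by simp
next
  case (Suc k)
  have "3 ^ k * (m + 1) > 0" by simp
  then have "3 ^ Suc k * (m + 1) - 1 = 3 * (3 ^ k * (m + 1) - 1) + 2"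
    by (simp only: power_Suc mult.assoc)
  then have "B3 (3 ^ Suc k * (m + 1) - 1) = 9 * B3 (3 ^ k * (m + 1) - 1)"
    by (simp only: B3_rec)
  then show ?case
    by (simp only: Suc.IH power_Suc mult.assoc)
qed

text \<open>The cyclic shift acts on the triples of 3-cores with total size \<open>n\<close>. A triple fixed by it consists of
three equal cores, which is impossible for a size not divisible by 3; hence all orbits have exactly three
elements.\<close>

lemma three_dvd_B3:
  assumes "\<not> 3 dvd n"
  shows "3 dvd B3 n"
proof -
  define S where "S = core_triples 3 n"
  define orbit :: "nat list \<times> nat list \<times> nat list \<Rightarrow> (nat list \<times> nat list \<times> nat list) set"
    where "orbit = (\<lambda>(a, b, c). {(a, b, c), (b, c, a), (c, a, b)})"
  have union: "\<Union> (orbit ` S) = S"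
    by (auto simp: orbit_def S_def core_triples_def)
  have fin: "finite S" by (simp add: S_def finite_core_triples)
  have "3 * card (orbit ` S) = card (\<Union> (orbit ` S))"
  proof (rule card_partition)
    show "finite (orbit ` S)" "finite (\<Union> (orbit ` S))" using fin union by auto
    show "card c = 3" if c_in: "c \<in> orbit ` S" for c
    proof -
      obtain xs ys zs where c: "c = orbit (xs, ys, zs)"
        and n: "sum_list xs + sum_list ys + sum_list zs = n"
        using c_in by (auto simp: S_def core_triples_def)
      have "\<not> (xs = ys \<and> ys = zs)"
      proof
        assume "xs = ys \<and> ys = zs"
        then have "n = 3 * sum_list xs" using n by simp
        then show False using assms by simp
      qed
      then have "(xs, ys, zs) \<noteq> (ys, zs, xs)" "(xs, ys, zs) \<noteq> (zs, xs, ys)"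
        "(ys, zs, xs) \<noteq> (zs, xs, ys)"
        by (metis prod.inject)+
      then show ?thesis by (simp add: c orbit_def del: prod.inject)
    qed
    show "c \<inter> d = {}" if "c \<in> orbit ` S" "d \<in> orbit ` S" "c \<noteq> d" for c d
    proof -
      have "orbit w = orbit v" if "w \<in> orbit v" for v w
        using that by (cases v) (auto simp: orbit_def)
      then show ?thesis using that by (metis (no_types, lifting) disjoint_iff imageE)
    qed
  qed
  then show ?thesis
    unfolding union by (metis B3_def S_def dvd_triv_left)
qed

theorem corollary2p2:
  fixes k n :: nat
  assumes "k \<ge> 1"
  shows "[B3 (3 ^ k * n + 3 ^ k - 1) = 0] (mod 3 ^ (2 * k)) \<and>
         [B3 (3 ^ k * n + 2 * 3 ^ (k - 1) - 1) = 0] (mod 3 ^ (2 * k - 1))"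
proof
  have nine: "(9::nat) ^ j = 3 ^ (2 * j)" for j by (simp add: power_mult)
  have "B3 (3 ^ k * n + 3 ^ k - 1) = 3 ^ (2 * k) * B3 n"
    using B3_iterate[of k n] by (simp add: nine add.commute)
  then show "[B3 (3 ^ k * n + 3 ^ k - 1) = 0] (mod 3 ^ (2 * k))"
    by (simp add: cong_0_iff)
  obtain j where k: "k = Suc j" using assms by (cases k) auto
  have "3 ^ k * n + 2 * 3 ^ (k - 1) - 1 = 3 ^ j * ((3 * n + 1) + 1) - (1::nat)"
    by (simp add: k algebra_simps)
  then have "B3 (3 ^ k * n + 2 * 3 ^ (k - 1) - 1) = 3 ^ (2 * j) * B3 (3 * n + 1)"
    by (simp only: B3_iterate nine)
  moreover have "3 dvd B3 (3 * n + 1)"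
    by (rule three_dvd_B3) presburger
  moreover have "(3::nat) ^ (2 * k - 1) = 3 ^ (2 * j) * 3" by (simp add: k)
  ultimately show "[B3 (3 ^ k * n + 2 * 3 ^ (k - 1) - 1) = 0] (mod 3 ^ (2 * k - 1))"
    by (simp add: cong_0_iff)
qed

end
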